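(* For any $\beta\in(1,2)$, the set $\mathfrak{R}_{\beta}(x)$ has the cardinality of the continuum for Lebesgue-almost every $x\in\left(0,\frac{1}{\beta-1}\right)$.
   Context: For $\beta\in(1,2)$ and $x\ge 0$, $\mathfrak{R}_\beta(x)$ denotes the set of all $\beta$-expansions of $x$ with digits $0,1$: $$\mathfrak{R}_\beta(x)=\left\{(\varepsilon_n)_{n=1}^\infty\in\prod_{n=1}^\infty\{0,1\} : x=\sum_{n=1}^\infty \varepsilon_n\beta^{-n}\right\}.$$ *)

theory Defs
  imports "HOL-Analysis.Analysis" "HOL-Library.Equipollence"
begin

text \<open>The set of beta-expansions of \<open>x\<close> with digits 0 and 1. Digit sequences are indexed from 0, so
  \<open>\<epsilon> n\<close> is the digit with weight \<open>\<beta> ^ -(n + 1)\<close>.\<close>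

definition beta_expansions :: "real \<Rightarrow> real \<Rightarrow> (nat \<Rightarrow> nat) set" where
  "beta_expansions \<beta> x =
     {\<epsilon>. (\<forall>n. \<epsilon> n \<in> {0, 1}) \<and> (\<lambda>n. real (\<epsilon> n) / \<beta> ^ Suc n) sums x}"

end

theory Submission
  imports Defs
begin

text \<open>
  Write \<open>\<kappa> = 1 / (\<beta> - 1)\<close>. After the digits of a word \<open>w\<close> have been removed from a number \<open>x\<close>, what
  remains to be expanded is \<open>residue \<beta> w x\<close>, an affine function of \<open>x\<close> with slope
  \<open>\<beta> ^ length w\<close>. A word begins some expansion of \<open>x\<close> exactly if its residue lies in \<open>{0..\<kappa>}\<close>, so
  these words form a tree without dead ends whose infinite branches are expansions of \<open>x\<close>.
  The tree branches at \<open>w\<close>, i.e. either digit may follow, when the residue lies in the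
  switch region \<open>{1 / \<beta>..\<kappa> / \<beta>}\<close>, an interval of positive length since \<open>\<kappa> > 1\<close>.

  Let \<open>never_switching\<close> be the set of points of \<open>{0..\<kappa>}\<close> that no word takes into the switch region.
  It is null: every point of it lies, for each length \<open>n\<close>, in an interval of length \<open>\<kappa> / \<beta> ^ n\<close>
  that a word of length \<open>n\<close> maps onto \<open>{0..\<kappa>}\<close>, and the preimage of the switch region is a hole
  that occupies a fixed proportion of this interval. Sets with such holes have no density
  points; \<open>negligible_if_proportional_holes\<close> derives this from the Vitali covering theorem.

  The points \<open>x\<close> with some residue in \<open>never_switching\<close> form a countable union of affine preimages of
  a null set, again a null set. For any other \<open>x\<close>, branching occurs above every node of the
  tree. The branches of such a tree form a perfect set in a completely metrizable space and
  so number at least the continuum (\<open>continuum_lepoll_branches_perfect_tree\<close>). There are never more,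
  because a sequence of digits 0 and 1 is a set of natural numbers.
\<close>

section \<open>Sets with proportional holes at every small scale are null\<close>

text \<open>
  By contradiction: were \<open>E\<close> of positive measure, an open \<open>U \<supseteq> E\<close> of nearly the same measure would
  contain disjoint balls that cover almost all of \<open>E\<close>; as each ball meets \<open>E\<close> in at most the
  proportion \<open>c\<close> of its own measure, \<open>E\<close> would have measure at most \<open>c\<close> times that of \<open>U\<close>.
\<close>

lemma negligible_if_proportional_holes:
  fixes E :: "'a::euclidean_space set"
  assumes E: "E \<in> lmeasurable" and c: "0 \<le> c" "c < 1"
    and holes: "\<And>x d. x \<in> E \<Longrightarrow> 0 < d \<Longrightarrow> \<exists>a r. 0 < r \<and> r < d \<and> x \<in> cball a r \<and>
       measure lebesgue (E \<inter> cball a r) \<le> c * measure lebesgue (cball a r)"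
  shows "negligible E"
proof (rule ccontr)
  let ?\<mu> = "measure lebesgue"
  assume "\<not> negligible E"
  then have pos: "0 < ?\<mu> E"
    using E by (simp add: negligible_iff_measure zero_less_measure_iff)
  \<comment> \<open>chosen so that \<open>c * (\<mu> E + e) < \<mu> E\<close>\<close>
  define e where "e = (1 - c) * ?\<mu> E"
  have "0 < e"
    using pos c by (simp add: e_def)
  have "E \<in> sets lebesgue"
    using E by blast
  then obtain U where U: "open U" "E \<subseteq> U" "U - E \<in> lmeasurable"
      "emeasure lebesgue (U - E) < ennreal e"
    using sets_lebesgue_outer_open \<open>0 < e\<close> by metis
  have "?\<mu> (U - E) < e"
    using U(3,4) by (simp add: emeasure_eq_measure2 ennreal_less_iff)
  moreover have Ueq: "U = E \<union> (U - E)"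
    using U(2) by blast
  moreover have "?\<mu> (E \<union> (U - E)) \<le> ?\<mu> E + ?\<mu> (U - E)"
    using E U(3) by (intro measure_Un_le) blast+
  ultimately have \<mu>U: "?\<mu> U < ?\<mu> E + e"
    by simp
  have mU: "U \<in> lmeasurable"
    using fmeasurable.Un[OF E U(3)] Ueq by simp
  let ?B = "\<lambda>i::'a \<times> real. cball (fst i) (snd i)"
  define K where "K = {i. 0 < snd i \<and> ?B i \<subseteq> U \<and> ?\<mu> (E \<inter> ?B i) \<le> c * ?\<mu> (?B i)}"
  have cover: "\<exists>i. i \<in> K \<and> x \<in> ?B i \<and> snd i < d" if "x \<in> E" and "0 < d" for x d
  proof -
    have "x \<in> U"
      using U(2) \<open>x \<in> E\<close> by (rule subsetD)
    with U(1) obtain \<delta> where \<delta>: "0 < \<delta>" "ball x \<delta> \<subseteq> U"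
      by (rule openE)
    \<comment> \<open>\<open>x\<close> need not be the centre: half of \<open>\<delta>\<close> as radius keeps the ball inside \<open>ball x \<delta>\<close>\<close>
    obtain a r where ar: "0 < r" "r < min d (\<delta> / 2)" "x \<in> cball a r"
        "?\<mu> (E \<inter> cball a r) \<le> c * ?\<mu> (cball a r)"
      using holes[OF \<open>x \<in> E\<close>, of "min d (\<delta> / 2)"] \<open>0 < d\<close> \<delta>(1) by auto
    have "cball a r \<subseteq> ball x \<delta>"
    proof
      fix y assume "y \<in> cball a r"
      moreover have "dist x y \<le> dist a x + dist a y"
        by (metis dist_commute dist_triangle)
      ultimately show "y \<in> ball x \<delta>"
        using ar by simp
    qed
    then have "(a, r) \<in> K"
      using ar \<delta>(2) by (auto simp: K_def)
    then show ?thesis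
      using ar by (intro exI[of _ "(a, r)"]) auto
  qed
  obtain C where C: "countable C" "C \<subseteq> K"
      "pairwise (\<lambda>i j. disjnt (?B i) (?B j)) C" "negligible (E - (\<Union>i\<in>C. ?B i))"
    using Vitali_covering_theorem_cballs[of K snd E fst] cover K_def by auto
  have mEB: "E \<inter> ?B i \<in> lmeasurable" for i
    using E by (intro fmeasurable.Int) auto
  have bound: "?\<mu> (\<Union>i\<in>F. E \<inter> ?B i) \<le> c * ?\<mu> U" if F: "F \<subseteq> C" "finite F" for F
  proof -
    have "?\<mu> (\<Union>i\<in>F. E \<inter> ?B i) \<le> (\<Sum>i\<in>F. ?\<mu> (E \<inter> ?B i))"
      using mEB by (intro measure_UNION_le F) blast
    also have "\<dots> \<le> (\<Sum>i\<in>F. c * ?\<mu> (?B i))"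
      using F C(2) by (intro sum_mono) (auto simp: K_def)
    also have "\<dots> = c * ?\<mu> (\<Union>i\<in>F. ?B i)"
      using F by (subst measure_UNION') (auto simp: sum_distrib_left intro: pairwise_mono[OF C(3)])
    also have "\<dots> \<le> c * ?\<mu> U"
    proof (intro mult_left_mono measure_mono_fmeasurable)
      show "(\<Union>i\<in>F. ?B i) \<subseteq> U"
        using F C(2) by (auto simp: K_def)
      show "(\<Union>i\<in>F. ?B i) \<in> sets lebesgue"
        by (intro sets.finite_UN F) auto
    qed (use c mU in auto)
    finally show ?thesis .
  qed
  have "?\<mu> E = ?\<mu> (\<Union>i\<in>C. E \<inter> ?B i)"
    by (rule measure_negligible_symdiff[OF E, symmetric]) (rule negligible_subset[OF C(4)], auto)
  also have "\<dots> \<le> c * ?\<mu> U"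
    by (rule measure_UN_bound[OF C(1) mEB bound])
  also have "\<dots> \<le> c * (?\<mu> E + e)"
    using \<mu>U c by (intro mult_left_mono) auto
  also have "\<dots> < ?\<mu> E"
  proof -
    have "?\<mu> E - c * (?\<mu> E + e) = (1 - c) * (1 - c) * ?\<mu> E"
      by (simp add: e_def algebra_simps)
    then show ?thesis
      using pos c by (smt (verit) mult_pos_pos)
  qed
  finally show False by simp
qed

section \<open>Perfect trees have continuum many branches\<close>

text \<open>
  A tree is given by the predicate \<open>P\<close> on its nodes, the finite words. Repeated choice of a
  successor yields a chain of nodes above \<open>w\<close>, and the branch is their limit.
\<close>

lemma pruned_tree_branch:
  assumes prefix: "\<And>u v. P (u @ v) \<Longrightarrow> P u" and extend: "\<And>u. P u \<Longrightarrow> \<exists>d. P (u @ [d])"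
    and "P w"
  obtains \<epsilon> where "map \<epsilon> [0..<length w] = w" "\<And>n. P (map \<epsilon> [0..<n])"
proof -
  define L where "L = rec_nat w (\<lambda>_ u. u @ [SOME d. P (u @ [d])])"
  have L0: "L 0 = w" and LS: "L (Suc n) = L n @ [SOME d. P (L n @ [d])]" for n
    by (simp_all add: L_def)
  have PL: "P (L n)" for n
    by (induction n) (auto simp: L0 LS \<open>P w\<close> intro: someI_ex extend)
  have len: "length (L n) = length w + n" for n
    by (induction n) (auto simp: L0 LS)
  have "\<exists>v. L (n + k) = L n @ v" for n k
    by (induction k) (auto simp: LS)
  then have nth: "L (n + k) ! i = L n ! i" if "i < length w + n" for n k i
    using that len by (metis nth_append)
  \<comment> \<open>\<open>L (Suc i)\<close> has more than \<open>i\<close> letters even if \<open>w\<close> is empty\<close>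
  define \<epsilon> where "\<epsilon> i = L (Suc i) ! i" for i
  have \<epsilon>: "\<epsilon> i = L n ! i" if "i < length w + n" for i n
  proof (cases "n \<le> Suc i")
    case True
    then obtain k where "Suc i = n + k" using le_Suc_ex by blast
    then show ?thesis using nth[OF that] by (simp add: \<epsilon>_def)
  next
    case False
    then obtain k where "n = Suc i + k" using le_Suc_ex nat_le_linear by blast
    then show ?thesis using nth[of i "Suc i" k] by (simp add: \<epsilon>_def)
  qed
  have "map \<epsilon> [0..<length w + n] = L n" for n
    by (rule nth_equalityI) (auto simp: len \<epsilon>)
  note L = this
  show thesis
  proof
    show "map \<epsilon> [0..<length w] = w"
      using L[of 0] by (simp add: L0)
    show "P (map \<epsilon> [0..<n])" for n
    proof (rule prefix)
      show "P (map \<epsilon> [0..<n] @ map \<epsilon> [n..<length w + n])"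
        using PL[of n] unfolding L[symmetric]
        by (metis le_add2 map_append upt_add_eq_append zero_le le_add_diff_inverse)
    qed
  qed
qed

text \<open>
  In the product of countably many discrete spaces, which is completely metrizable, the set of
  branches is closed because being a branch is a condition on each initial segment separately.
  No branch is isolated: above any of its nodes the tree splits, and one of the two sides
  carries a branch different from the given one.
\<close>

lemma continuum_lepoll_branches_perfect_tree:
  fixes P :: "'a list \<Rightarrow> bool"
  assumes prefix: "\<And>u v. P (u @ v) \<Longrightarrow> P u" and extend: "\<And>u. P u \<Longrightarrow> \<exists>d. P (u @ [d])"
    and root: "P []"
    and split: "\<And>u. P u \<Longrightarrow> \<exists>v d e. d \<noteq> e \<and> P (u @ v @ [d]) \<and> P (u @ v @ [e])"
  shows "(UNIV :: real set) \<lesssim> {\<epsilon>. \<forall>n. P (map \<epsilon> [0..<n])}" (is "_ \<lesssim> ?S")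
proof (rule lepoll_perfect_set)
  let ?X = "product_topology (\<lambda>_::nat. discrete_topology (UNIV :: 'a set)) UNIV"
  show "completely_metrizable_space ?X \<or> locally_compact_space ?X \<and> Hausdorff_space ?X"
    by (simp add: completely_metrizable_space_product_topology
        completely_metrizable_space_discrete_topology)
  have branch: "\<exists>\<epsilon>. map \<epsilon> [0..<length w] = w \<and> \<epsilon> \<in> ?S" if "P w" for w
    by (rule pruned_tree_branch[of P w]) (use prefix extend that in blast)+
  show "?S \<noteq> {}"
    using branch[OF root] by blast
  have cyl: "openin ?X {\<delta>. map \<delta> [0..<n] = map \<epsilon> [0..<n]}" for \<epsilon> n
  proof -
    have "openin ?X (\<Pi>\<^sub>E i\<in>UNIV. if i < n then {\<epsilon> i} else UNIV)"
      by (rule product_topology_basis) (auto intro: finite_subset[of _ "{..<n}"])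
    also have "(\<Pi>\<^sub>E i\<in>UNIV. if i < n then {\<epsilon> i} else UNIV) = {\<delta>. map \<delta> [0..<n] = map \<epsilon> [0..<n]}"
      by (auto simp: PiE_iff split: if_splits)
    finally show ?thesis .
  qed
  show "?X derived_set_of ?S = ?S"
  proof (intro equalityI subsetI)
    fix \<epsilon> assume \<epsilon>: "\<epsilon> \<in> ?X derived_set_of ?S"
    have "P (map \<epsilon> [0..<n])" for n
    proof -
      have "\<exists>\<delta>. \<delta> \<noteq> \<epsilon> \<and> \<delta> \<in> ?S \<and> \<delta> \<in> {\<delta>. map \<delta> [0..<n] = map \<epsilon> [0..<n]}"
        by (rule \<epsilon>[unfolded in_derived_set_of, THEN conjunct2, rule_format])
           (intro conjI cyl CollectI refl)
      then obtain \<delta> where \<delta>: "\<forall>k. P (map \<delta> [0..<k])" "map \<delta> [0..<n] = map \<epsilon> [0..<n]"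
        by (elim exE conjE CollectE)
      from \<delta>(1) have "P (map \<delta> [0..<n])" ..
      then show ?thesis
        unfolding \<delta>(2) .
    qed
    then show "\<epsilon> \<in> ?S" by blast
  next
    fix \<epsilon> assume \<epsilon>: "\<epsilon> \<in> ?S"
    have "\<exists>\<delta>. \<delta> \<noteq> \<epsilon> \<and> \<delta> \<in> ?S \<and> \<delta> \<in> T" if T: "\<epsilon> \<in> T" "openin ?X T" for T
    proof -
      obtain X where X: "\<epsilon> \<in> Pi\<^sub>E UNIV X" "finite {i. X i \<noteq> UNIV}" "Pi\<^sub>E UNIV X \<subseteq> T"
        using product_topology_open_contains_basis[OF T(2,1)] by auto
      obtain n where n: "\<And>i. X i \<noteq> UNIV \<Longrightarrow> i < n"
        using X(2) finite_nat_set_iff_bounded by auto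
      let ?u = "map \<epsilon> [0..<n]"
      obtain v d e where vde: "d \<noteq> e" "P (?u @ v @ [d])" "P (?u @ v @ [e])"
        using split \<epsilon> by blast
      obtain c where "c \<noteq> \<epsilon> (n + length v)" "P (?u @ v @ [c])"
        using vde by metis
      then obtain \<delta> where \<delta>: "map \<delta> [0..<length (?u @ v @ [c])] = ?u @ v @ [c]" "\<delta> \<in> ?S"
        using branch by blast
      have \<delta>_nth: "\<delta> i = (?u @ v @ [c]) ! i" if "i < length (?u @ v @ [c])" for i
        using arg_cong[OF \<delta>(1), of "\<lambda>l. l ! i"] that by (simp del: append_assoc upt_Suc)
      have "\<delta> (n + length v) = c"
        using \<delta>_nth[of "n + length v"] by (simp add: nth_append)
      moreover have "\<delta> i = \<epsilon> i" if "i < n" for i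
        using \<delta>_nth[of i] that by (simp add: nth_append)
      then have "\<delta> \<in> Pi\<^sub>E UNIV X"
        using X(1) n by (auto simp: PiE_iff) (metis UNIV_I)
      then have "\<delta> \<in> T"
        using X(3) by (rule subsetD[rotated])
      ultimately show ?thesis
        using \<delta>(2) \<open>c \<noteq> _\<close> by (intro exI[of _ \<delta>] conjI) auto
    qed
    then show "\<epsilon> \<in> ?X derived_set_of ?S"
      unfolding in_derived_set_of by simp
  qed
qed

section \<open>Digit words and the residues they leave\<close>

text \<open>
  \<open>residue \<beta> w x\<close> is the number that the remaining digits must expand if an expansion of \<open>x\<close> begins
  with \<open>w\<close>: each digit \<open>d\<close> acts by \<open>y \<mapsto> \<beta> * y - d\<close>.
\<close>

fun residue :: "real \<Rightarrow> nat list \<Rightarrow> real \<Rightarrow> real" where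
  "residue \<beta> [] x = x"
| "residue \<beta> (d # w) x = residue \<beta> w (\<beta> * x - real d)"

lemma residue_append: "residue \<beta> (u @ v) x = residue \<beta> v (residue \<beta> u x)"
  by (induction u arbitrary: x) auto

lemma residue_affine: "residue \<beta> w x = \<beta> ^ length w * x + residue \<beta> w 0"
proof (induction w arbitrary: x)
  case (Cons d w)
  show ?case
    using Cons[of "\<beta> * x - real d"] Cons[of "- real d"] by (simp add: algebra_simps)
qed simp

lemma residue_map_upt:
  assumes "\<beta> \<noteq> 0"
  shows "residue \<beta> (map \<epsilon> [0..<n]) x = \<beta> ^ n * (x - (\<Sum>k<n. real (\<epsilon> k) / \<beta> ^ Suc k))"
proof (induction n)
  case (Suc n)
  then have "residue \<beta> (map \<epsilon> [0..<Suc n]) x =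
      \<beta> * (\<beta> ^ n * (x - (\<Sum>k<n. real (\<epsilon> k) / \<beta> ^ Suc k))) - real (\<epsilon> n)"
    by (simp add: residue_append)
  also have "real (\<epsilon> n) = \<beta> ^ Suc n * (real (\<epsilon> n) / \<beta> ^ Suc n)"
    using assms by simp
  finally show ?case
    by (simp only: power_Suc sum.lessThan_Suc mult.assoc right_diff_distrib distrib_left)
qed simp

abbreviation binary_words :: "nat list set" where
  "binary_words \<equiv> lists {0, 1}"

locale beta_base =
  fixes \<beta> :: real
  assumes \<beta>: "1 < \<beta>" "\<beta> < 2"
begin

text \<open>The largest number with an expansion, the sum of all \<open>\<beta> ^ -(n + 1)\<close>.\<close>

definition top_value :: real ("\<kappa>") where
  "\<kappa> = 1 / (\<beta> - 1)"

lemma \<beta>_times_top_value: "\<beta> * \<kappa> = \<kappa> + 1"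
  using \<beta> by (simp add: top_value_def field_simps)

lemma top_value_gt_1: "1 < \<kappa>"
  using \<beta> by (simp add: top_value_def field_simps)

text \<open>
  Both inverse branches \<open>y \<mapsto> (y + d) / \<beta>\<close> map \<open>{0..\<kappa>}\<close> into itself, since \<open>(\<kappa> + 1) / \<beta> = \<kappa>\<close>.
  So a residue that has left this interval never returns.
\<close>

lemma residue_in_range_imp:
  assumes "w \<in> binary_words" "residue \<beta> w x \<in> {0..\<kappa>}"
  shows "x \<in> {0..\<kappa>}"
  using assms
proof (induction w arbitrary: x rule: lists.induct)
  case (Cons d w)
  have "\<beta> * x - real d \<in> {0..\<kappa>}"
    using Cons.IH[of "\<beta> * x - real d"] Cons.prems by simp
  with \<open>d \<in> {0, 1}\<close> have "0 \<le> \<beta> * x" "\<beta> * x \<le> \<beta> * \<kappa>"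
    unfolding \<beta>_times_top_value by auto
  then show ?case
    using \<beta> by (simp add: zero_le_mult_iff)
qed simp

text \<open>Digit 0 works up to \<open>\<kappa> / \<beta>\<close> and digit 1 from \<open>1 / \<beta>\<close> on; these ranges cover \<open>{0..\<kappa>}\<close>
  because \<open>1 < \<kappa>\<close>, which amounts to \<open>\<beta> < 2\<close>.\<close>

lemma digit_exists:
  assumes "x \<in> {0..\<kappa>}"
  shows "\<exists>d\<in>{0, 1}. \<beta> * x - real d \<in> {0..\<kappa>}"
proof (cases "\<beta> * x \<le> \<kappa>")
  case True
  then show ?thesis using assms \<beta> by auto
next
  case False
  moreover have "\<beta> * x \<le> \<kappa> + 1"
    using assms \<beta> unfolding \<beta>_times_top_value[symmetric] by auto
  ultimately show ?thesis using top_value_gt_1 by auto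
qed

lemma word_exists:
  assumes "x \<in> {0..\<kappa>}"
  shows "\<exists>w\<in>binary_words. length w = n \<and> residue \<beta> w x \<in> {0..\<kappa>}"
proof (induction n)
  case 0
  then show ?case using assms by (intro bexI[of _ "[]"]) auto
next
  case (Suc n)
  then obtain w where w: "w \<in> binary_words" "length w = n" "residue \<beta> w x \<in> {0..\<kappa>}"
    by blast
  from digit_exists[OF w(3)]
  obtain d where "d \<in> {0, 1}" "\<beta> * residue \<beta> w x - real d \<in> {0..\<kappa>}" ..
  then show ?case
    using w by (intro bexI[of _ "w @ [d]"]) (auto simp: residue_append)
qed

text \<open>
  The error of the partial sum of length \<open>n\<close> is the residue divided by \<open>\<beta> ^ n\<close>, so bounded residues
  force convergence to \<open>x\<close>.
\<close>

lemma beta_expansion_if_residues_in_range: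
  assumes dig: "\<And>n. \<epsilon> n \<in> {0, 1}" and res: "\<And>n. residue \<beta> (map \<epsilon> [0..<n]) x \<in> {0..\<kappa>}"
  shows "\<epsilon> \<in> beta_expansions \<beta> x"
proof -
  let ?s = "\<lambda>n. \<Sum>k<n. real (\<epsilon> k) / \<beta> ^ Suc k"
  have "\<bar>x - ?s n\<bar> \<le> \<kappa> * (1 / \<beta>) ^ n" for n
    using res[of n] \<beta> by (auto simp: residue_map_upt field_simps zero_le_mult_iff)
  moreover have "(\<lambda>n. \<kappa> * (1 / \<beta>) ^ n) \<longlonglongrightarrow> 0"
    using \<beta> by (intro tendsto_mult_right_zero LIMSEQ_power_zero) auto
  ultimately have "(\<lambda>n. x - ?s n) \<longlonglongrightarrow> 0"
    by - (rule Lim_null_comparison[OF always_eventually, rotated], assumption, simp only: real_norm_def, blast)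
  then have "(\<lambda>n. x - (x - ?s n)) \<longlonglongrightarrow> x - 0"
    by (rule tendsto_diff[OF tendsto_const])
  then show ?thesis
    using dig by (simp add: beta_expansions_def sums_def)
qed

section \<open>Almost every point reaches the switch region\<close>

definition switch_region :: "real set" where
  "switch_region = {1 / \<beta>..\<kappa> / \<beta>}"

definition never_switching :: "real set" where
  "never_switching = {x \<in> {0..\<kappa>}. \<forall>w\<in>binary_words. residue \<beta> w x \<notin> switch_region}"

lemma both_digits_if_switch_region:
  assumes "y \<in> switch_region" "d \<in> {0, 1}"
  shows "\<beta> * y - real d \<in> {0..\<kappa>}"
proof -
  have "1 \<le> \<beta> * y" "\<beta> * y \<le> \<kappa>"
    using assms(1) \<beta> by (auto simp: switch_region_def field_simps)
  then show ?thesis using assms(2) by auto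
qed

lemma never_switching_lmeasurable: "never_switching \<in> lmeasurable"
proof -
  have "closed (residue \<beta> w -` switch_region)" for w
  proof (rule closed_vimage)
    show "closed switch_region"
      by (simp add: switch_region_def)
    show "continuous_on UNIV (residue \<beta> w)"
      by (subst residue_affine[abs_def]) (intro continuous_intros)
  qed
  then have "(\<Union>w\<in>binary_words. residue \<beta> w -` switch_region) \<in> sets borel"
    by (intro sets.countable_UN' countable_lists) (auto intro: borel_closed)
  then have "{0..\<kappa>} - (\<Union>w\<in>binary_words. residue \<beta> w -` switch_region) \<in> lmeasurable"
    by (intro fmeasurable_Diff) auto
  also have "{0..\<kappa>} - (\<Union>w\<in>binary_words. residue \<beta> w -` switch_region) = never_switching"
    by (auto simp: never_switching_def)
  finally show ?thesis .
qed

text \<open>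
  For each word \<open>w\<close> the affine map \<open>residue \<beta> w\<close> stretches some interval onto \<open>{0..\<kappa>}\<close>. It preserves
  proportions of lengths, so the preimage of the switch region takes up in that interval the share \<open>(\<kappa> - 1) / (\<beta> * \<kappa>)\<close> that the switch region has
  in \<open>{0..\<kappa>}\<close>, whatever the length of \<open>w\<close>.
\<close>

lemma negligible_never_switching: "negligible never_switching"
proof (rule negligible_if_proportional_holes[OF never_switching_lmeasurable])
  define c where "c = 1 - (\<kappa> - 1) / (\<beta> * \<kappa>)"
  show "0 \<le> c" "c < 1"
    using top_value_gt_1 \<beta> unfolding c_def \<beta>_times_top_value by (auto simp: field_simps)
  fix x d :: real
  assume x: "x \<in> never_switching" and "0 < d"
  obtain n where n: "(1 / \<beta>) ^ n < d / \<kappa>"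
    using real_arch_pow_inv[of "d / \<kappa>" "1 / \<beta>"] \<beta> \<open>0 < d\<close> top_value_gt_1 by auto
  obtain w where w: "w \<in> binary_words" "length w = n" "residue \<beta> w x \<in> {0..\<kappa>}"
    using word_exists[of x n] x by (auto simp: never_switching_def)
  define q where "q = \<beta> ^ n"
  have "0 < q" using \<beta> by (simp add: q_def)
  define b where "b = residue \<beta> w 0"
  have res: "residue \<beta> w y = q * y + b" for y
    using residue_affine[of \<beta> w y] w(2) by (simp add: q_def b_def)
  \<comment> \<open>half the length, and then the midpoint, of the preimage of \<open>{0..\<kappa>}\<close> under \<open>y \<mapsto> q * y + b\<close>\<close>
  define r where "r = \<kappa> / (2 * q)"
  define a where "a = r - b / q"
  have "0 < r"
    using top_value_gt_1 \<open>0 < q\<close> by (simp add: r_def)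
  have "\<kappa> / q < d"
    using n top_value_gt_1 by (simp add: q_def field_simps)
  then have "r < d"
    using \<open>0 < r\<close> by (simp add: r_def)
  have ball: "cball a r = {- b / q..(\<kappa> - b) / q}"
    using \<open>0 < q\<close> unfolding cball_eq_atLeastAtMost by (simp add: a_def r_def field_simps)
  let ?hole = "{(1 / \<beta> - b) / q..(\<kappa> / \<beta> - b) / q}"
  have hole: "residue \<beta> w y \<in> switch_region \<longleftrightarrow> y \<in> ?hole" for y
    using \<open>0 < q\<close> by (auto simp: res switch_region_def field_simps)
  have \<mu>ball: "measure lebesgue (cball a r) = \<kappa> / q"
    using \<open>0 < q\<close> top_value_gt_1 unfolding ball by (simp add: field_simps)
  have \<mu>hole: "measure lebesgue ?hole = (\<kappa> - 1) / \<beta> / q"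
    using \<open>0 < q\<close> \<beta> top_value_gt_1 by (simp add: field_simps)
  have "?hole \<subseteq> cball a r"
  proof -
    have "0 \<le> 1 / \<beta>" "\<kappa> / \<beta> \<le> \<kappa>"
      using \<beta> top_value_gt_1 by (auto simp: field_simps)
    then show ?thesis
      using \<open>0 < q\<close> unfolding ball by (auto simp: field_simps)
  qed
  have "never_switching \<inter> cball a r \<subseteq> cball a r - ?hole"
  proof
    fix y assume y: "y \<in> never_switching \<inter> cball a r"
    then have "residue \<beta> w y \<notin> switch_region"
      using w(1) unfolding never_switching_def by blast
    then show "y \<in> cball a r - ?hole"
      using y hole by blast
  qed
  then have "measure lebesgue (never_switching \<inter> cball a r) \<le> measure lebesgue (cball a r - ?hole)"
    using never_switching_lmeasurable by (intro measure_mono_fmeasurable fmeasurable_Diff) auto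
  also have "\<dots> = measure lebesgue (cball a r) - measure lebesgue ?hole"
    using \<open>?hole \<subseteq> cball a r\<close> by (intro measurable_measure_Diff) auto
  also have "\<dots> = c * measure lebesgue (cball a r)"
    using \<open>0 < q\<close> \<beta> top_value_gt_1 unfolding \<mu>ball \<mu>hole c_def by (simp add: field_simps)
  finally have "measure lebesgue (never_switching \<inter> cball a r) \<le> c * measure lebesgue (cball a r)" .
  moreover have "x \<in> cball a r"
    using w(3) \<open>0 < q\<close> unfolding ball res by (auto simp: field_simps)
  ultimately show "\<exists>a r. 0 < r \<and> r < d \<and> x \<in> cball a r \<and>
      measure lebesgue (never_switching \<inter> cball a r) \<le> c * measure lebesgue (cball a r)"
    using \<open>0 < r\<close> \<open>r < d\<close> by blast
qed

text \<open>Excluding all points with a residue in \<open>never_switching\<close>, and not only the points in it,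
  makes the tree branch above each of its nodes instead of once.\<close>

definition exceptional :: "real set" where
  "exceptional = (\<Union>w\<in>binary_words. residue \<beta> w -` never_switching)"

lemma negligible_exceptional: "negligible exceptional"
proof -
  have "negligible {x \<in> UNIV. residue \<beta> w x \<in> never_switching}" for w
  proof (rule negligible_differentiable_vimage[OF negligible_never_switching])
    show "(residue \<beta> w has_derivative (\<lambda>h. \<beta> ^ length w * h)) (at x within UNIV)" for x
      by (subst residue_affine[abs_def]) (auto intro!: derivative_eq_intros)
    show "inj (\<lambda>h. \<beta> ^ length w * h)"
      using \<beta> by (auto simp: inj_on_def)
  qed
  then show ?thesis
    unfolding exceptional_def vimage_def
    by (intro negligible_countable_Union countable_image countable_lists) auto
qed

section \<open>Counting expansions\<close>

lemma beta_expansions_lepoll_continuum: "beta_expansions \<beta> x \<lesssim> (UNIV :: real set)"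
proof -
  have "inj_on (\<lambda>\<epsilon>. {n. \<epsilon> n = 1}) (beta_expansions \<beta> x)"
  proof (rule inj_onI)
    fix \<delta> \<epsilon> :: "nat \<Rightarrow> nat"
    assume "\<delta> \<in> beta_expansions \<beta> x" "\<epsilon> \<in> beta_expansions \<beta> x" "{n. \<delta> n = 1} = {n. \<epsilon> n = 1}"
    then have "\<delta> n \<in> {0, 1}" "\<epsilon> n \<in> {0, 1}" "\<delta> n = 1 \<longleftrightarrow> \<epsilon> n = 1" for n
      by (auto simp: beta_expansions_def)
    then show "\<delta> = \<epsilon>" by (intro ext) (metis empty_iff insert_iff)
  qed
  then have "beta_expansions \<beta> x \<lesssim> (UNIV :: nat set set)"
    unfolding lepoll_def by blast
  then show ?thesis
    using nat_sets_eqpoll_reals lepoll_trans2 by blast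
qed

lemma continuum_lepoll_beta_expansions:
  assumes x: "x \<in> {0..\<kappa>}" "x \<notin> exceptional"
  shows "(UNIV :: real set) \<lesssim> beta_expansions \<beta> x"
proof -
  define P where "P w \<longleftrightarrow> w \<in> binary_words \<and> residue \<beta> w x \<in> {0..\<kappa>}" for w
  have "(UNIV :: real set) \<lesssim> {\<epsilon>. \<forall>n. P (map \<epsilon> [0..<n])}"
  proof (rule continuum_lepoll_branches_perfect_tree)
    show "P u" if "P (u @ v)" for u v
      using that residue_in_range_imp[of v "residue \<beta> u x"] by (auto simp: P_def residue_append)
    show "\<exists>d. P (u @ [d])" if "P u" for u
      using that digit_exists[of "residue \<beta> u x"] by (auto simp: P_def residue_append)
    show "P []"
      using x by (simp add: P_def)
    show "\<exists>v d e. d \<noteq> e \<and> P (u @ v @ [d]) \<and> P (u @ v @ [e])" if "P u" for u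
    proof -
      have "residue \<beta> u x \<notin> never_switching"
        using that x(2) by (auto simp: P_def exceptional_def)
      then obtain v where v: "v \<in> binary_words" "residue \<beta> v (residue \<beta> u x) \<in> switch_region"
        using \<open>P u\<close> by (auto simp: P_def never_switching_def)
      then have "P (u @ v @ [d])" if "d \<in> {0, 1}" for d
        using \<open>P u\<close> both_digits_if_switch_region[OF v(2) that] that
        by (auto simp: P_def residue_append)
      then have "P (u @ v @ [0])" "P (u @ v @ [1])"
        by blast+
      then show ?thesis
        by (metis zero_neq_one)
    qed
  qed
  also have "{\<epsilon>. \<forall>n. P (map \<epsilon> [0..<n])} \<lesssim> beta_expansions \<beta> x"
  proof (rule subset_imp_lepoll, rule subsetI)
    fix \<epsilon> assume "\<epsilon> \<in> {\<epsilon>. \<forall>n. P (map \<epsilon> [0..<n])}"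
    then have P: "P (map \<epsilon> [0..<n])" for n by blast
    show "\<epsilon> \<in> beta_expansions \<beta> x"
    proof (rule beta_expansion_if_residues_in_range)
      show "\<epsilon> n \<in> {0, 1}" for n
        using P[of "Suc n"] by (auto simp: P_def)
      show "residue \<beta> (map \<epsilon> [0..<n]) x \<in> {0..\<kappa>}" for n
        using P by (simp add: P_def)
    qed
  qed
  finally show ?thesis .
qed

end

theorem theorem2p18:
  fixes \<beta> :: real
  assumes "1 < \<beta>" and "\<beta> < 2"
  shows "AE x\<in>{0<..<1 / (\<beta> - 1)} in lebesgue. beta_expansions \<beta> x \<approx> (UNIV :: real set)"
proof -
  interpret beta_base \<beta>
    using assms by unfold_locales
  show ?thesis
  proof (rule AE_I')
    show "exceptional \<in> null_sets lebesgue"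
      using negligible_exceptional negligible_iff_null_sets by blast
    have "beta_expansions \<beta> x \<approx> (UNIV :: real set)"
      if "x \<in> {0<..<1 / (\<beta> - 1)}" "x \<notin> exceptional" for x
      using that by (intro lepoll_antisym beta_expansions_lepoll_continuum
          continuum_lepoll_beta_expansions) (auto simp: top_value_def)
    then show "{x \<in> space lebesgue. \<not> (x \<in> {0<..<1 / (\<beta> - 1)} \<longrightarrow>
        beta_expansions \<beta> x \<approx> (UNIV :: real set))} \<subseteq> exceptional"
      by blast
  qed
qed

end
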